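(* Let $\mathcal L\in\{EL5^-,EL5\}\cup\{EkL5^-,EkL5: k\in\{4,5,6\}\}$, let $\mathcal M$ be an algebraic $\mathcal L$-model and $\gamma$ an assignment in $\mathcal M$. Then there is a relational model $\mathcal K=(\mathcal F,g)$ based on an $\mathcal L$-frame $\mathcal F$ such that for all formulas $\varphi$: $(\mathcal M,\gamma)\vDash\varphi$ iff $\mathcal K\vDash\varphi$.
   Context: Formulas are built from a set $V$ of variables using $\bot,\wedge,\vee,\rightarrow$ and unary $\square,K$. Algebraic models. An $EL3^-$-model is a Heyting algebra $(M,f_\bot,f_\top,f_\vee,f_\wedge,f_\rightarrow)$ (order $\le$, $f_\neg(m):=f_\rightarrow(m,f_\bot)$) with a designated ultrafilter $\mathit{TRUE}$, a set $\mathit{BEL}\subseteq M$ and unary operations $f_\square,f_K$ such that for all $m,m'$: (i) $f_\square(f_\vee(m,m'))\le f_\vee(f_\square(m),f_\square(m'))$; (ii) $f_\square(m)\le m$; (iii) $f_\square(f_\rightarrow(m,m'))\le f_\square(f_\rightarrow(f_\square(m),f_\square(m')))$; (iv) $f_\square(m)\in\mathit{TRUE}\iff m=f_\top$; (v) $f_K(m)\in\mathit{TRUE}\iff m\in\mathit{BEL}$; (vi) $f_K(f_\rightarrow(m,m'))\le f_\rightarrow(f_K(m),f_K(m'))$; (vii) $f_\square(m)\le f_\square(f_K(m))$. An $EL5^-$-model additionally has $f_\square(m)=f_\top$ if $m=f_\top$ and $f_\square(m)=f_\bot$ otherwise. $E4L5^-$-model: $EL5^-$-model with $f_K(m)\le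 f_K(f_K(m))$. $E5L5^-$-model: $E4L5^-$-model with $f_\neg(f_K(m))\le f_K(f_\neg(f_K(m)))$. $E6L5^-$-model: $EL5^-$-model with $f_K(m)\le f_\square(f_K(m))$ and $f_\neg(f_K(m))\le f_\square(f_\neg(f_K(m)))$. $EL5$- resp. $EkL5$-models are $EL5^-$- resp. $EkL5^-$-models with $f_K(m)\le f_\neg(f_\neg(m))$ for all $m$. An assignment $\gamma:V\to M$ extends homomorphically ($\gamma(\square\varphi)=f_\square(\gamma(\varphi))$, $\gamma(K\varphi)=f_K(\gamma(\varphi))$, etc.), and $(\mathcal M,\gamma)\vDash\varphi$ iff $\gamma(\varphi)\in\mathit{TRUE}$. Frames. An $EL5^-$-frame is $\mathcal F=(W,R,P,E,w_T)$: $W$ nonempty; $R$ a partial order with least element $w_\bot$ in which every chain has an upper bound; $R(w):=\{w': wRw'\}$; $Max(W)$ the $R$-maximal elements; $P$ a set of $R$-upward closed subsets of $W$; $E:W\to\mathcal P(P)$ with each $E(w)$ a filter on $P$ (nonempty, closed under $\cap$, upward closed in $P$) and $wRw'\Rightarrow E(w)\subseteq E(w')$; $w_T\in Max(W)$; $\varnothing,W\in P$ and $P$ closed under $\cap$, $\cup$, $A\supset B:=\{w:\forall w'\in R(w)(w'\in A\Rightarrow w'\in B)\}$, $KA:=\{w: A\in E(w)\}$. $E4L5^-$-frame: $A\in E(w)\Rightarrow\{w': A\in E(w')\}\in E(w)$. $E5L5^-$-frame: $E4L5^-$-frame such that if $A\notin E(w')$ for all $w'\in R(w)$ then $(\{w'':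 A\in E(w'')\}\supset\varnothing)\in E(w)$. $E6L5^-$-frame: $E(w)=E(w_\bot)$ for all $w$. $EL5$- (resp. $EkL5$-) frame: $EL5^-$- (resp. $EkL5^-$-) frame with $Max(W)\cap R(w)\subseteq A$ for all $w$ and $A\in E(w)$. Relational model $\mathcal K=(\mathcal F,g)$, $g:V\to P$; satisfaction: $w\nvDash\bot$; $w\vDash x$ iff $w\in g(x)$; $\vee,\wedge$ pointwise; $w\vDash\varphi\rightarrow\psi$ iff for all $w'\in R(w)$, $w'\vDash\varphi\Rightarrow w'\vDash\psi$; $w\vDash\square\varphi$ iff $w_\bot\vDash\varphi$; $w\vDash K\varphi$ iff $\{w': w'\vDash\varphi\}\in E(w)$. $\mathcal K\vDash\varphi$ iff $w_T\vDash\varphi$. *)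

theory Defs
  imports "HOL-Algebra.Lattice"
begin

section \<open>Formulas and logics\<close>

datatype 'v fm =
    Var 'v
  | Bot
  | And "'v fm" "'v fm"
  | Or "'v fm" "'v fm"
  | Imp "'v fm" "'v fm"
  | Box "'v fm"
  | Know "'v fm"

text \<open>\<open>Minus E4L5\<close> is the logic written $E4L5^-$, and \<open>Full E4L5\<close> is $E4L5$.\<close>

datatype el_base = EL5 | E4L5 | E5L5 | E6L5

datatype el_logic = Minus el_base | Full el_base


section \<open>Algebraic models\<close>

text \<open>
  The operations $f_\bot, f_\top, f_\vee, f_\wedge$ are those of the library's bounded
  lattices, which are determined by the carrier and the order; only the implication
  is an additional field.
\<close>

record 'a heyting = "'a gorder" +
  imp :: "['a, 'a] \<Rightarrow> 'a" (infixr \<open>\<leadsto>\<index>\<close> 60)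

locale heyting_algebra = bounded_lattice H for H :: "('a, 'b) heyting_scheme" (structure) +
  assumes imp_closed: "\<lbrakk>x \<in> carrier H; y \<in> carrier H\<rbrakk> \<Longrightarrow> x \<leadsto> y \<in> carrier H"
    and residuation: "\<lbrakk>x \<in> carrier H; y \<in> carrier H; z \<in> carrier H\<rbrakk> \<Longrightarrow>
      z \<sqsubseteq> x \<leadsto> y \<longleftrightarrow> z \<sqinter> x \<sqsubseteq> y"

definition neg :: "('a, 'b) heyting_scheme \<Rightarrow> 'a \<Rightarrow> 'a" where
  "neg H x = x \<leadsto>\<^bsub>H\<^esub> \<bottom>\<^bsub>H\<^esub>"

definition lattice_filter :: "('a, 'b) gorder_scheme \<Rightarrow> 'a set \<Rightarrow> bool" where
  "lattice_filter L F \<longleftrightarrow> F \<subseteq> carrier L \<and> F \<noteq> {} \<and>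
     (\<forall>x\<in>F. \<forall>y\<in>F. x \<sqinter>\<^bsub>L\<^esub> y \<in> F) \<and>
     (\<forall>x\<in>F. \<forall>y\<in>carrier L. x \<sqsubseteq>\<^bsub>L\<^esub> y \<longrightarrow> y \<in> F)"

definition lattice_ultrafilter :: "('a, 'b) gorder_scheme \<Rightarrow> 'a set \<Rightarrow> bool" where
  "lattice_ultrafilter L U \<longleftrightarrow> lattice_filter L U \<and> U \<noteq> carrier L \<and>
     (\<forall>F. lattice_filter L F \<and> F \<noteq> carrier L \<and> U \<subseteq> F \<longrightarrow> F = U)"

record 'a el_algebra = "'a heyting" +
  TRUE :: "'a set"
  BEL :: "'a set"
  box :: "'a \<Rightarrow> 'a"
  know :: "'a \<Rightarrow> 'a"

locale EL3_minus_model = heyting_algebra M for M :: "'a el_algebra" (structure) +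
  assumes TRUE_ultrafilter: "lattice_ultrafilter M (TRUE M)"
    and BEL_subset: "BEL M \<subseteq> carrier M"
    and box_closed: "x \<in> carrier M \<Longrightarrow> box M x \<in> carrier M"
    and know_closed: "x \<in> carrier M \<Longrightarrow> know M x \<in> carrier M"
    and box_join: "\<lbrakk>x \<in> carrier M; y \<in> carrier M\<rbrakk> \<Longrightarrow>
      box M (x \<squnion> y) \<sqsubseteq> box M x \<squnion> box M y"
    and box_le: "x \<in> carrier M \<Longrightarrow> box M x \<sqsubseteq> x"
    and box_imp: "\<lbrakk>x \<in> carrier M; y \<in> carrier M\<rbrakk> \<Longrightarrow>
      box M (x \<leadsto> y) \<sqsubseteq> box M (box M x \<leadsto> box M y)"
    and box_TRUE: "x \<in> carrier M \<Longrightarrow> box M x \<in> TRUE M \<longleftrightarrow> x = \<top>"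
    and know_TRUE: "x \<in> carrier M \<Longrightarrow> know M x \<in> TRUE M \<longleftrightarrow> x \<in> BEL M"
    and know_imp: "\<lbrakk>x \<in> carrier M; y \<in> carrier M\<rbrakk> \<Longrightarrow>
      know M (x \<leadsto> y) \<sqsubseteq> know M x \<leadsto> know M y"
    and box_know: "x \<in> carrier M \<Longrightarrow> box M x \<sqsubseteq> box M (know M x)"

locale EL5_minus_model = EL3_minus_model +
  assumes box_eq: "x \<in> carrier M \<Longrightarrow> box M x = (if x = \<top> then \<top> else \<bottom>)"

locale E4L5_minus_model = EL5_minus_model +
  assumes know_know: "x \<in> carrier M \<Longrightarrow> know M x \<sqsubseteq> know M (know M x)"

locale E5L5_minus_model = E4L5_minus_model +
  assumes neg_know: "x \<in> carrier M \<Longrightarrow> neg M (know M x) \<sqsubseteq> know M (neg M (know M x))"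

locale E6L5_minus_model = EL5_minus_model +
  assumes know_box: "x \<in> carrier M \<Longrightarrow> know M x \<sqsubseteq> box M (know M x)"
    and neg_know_box: "x \<in> carrier M \<Longrightarrow> neg M (know M x) \<sqsubseteq> box M (neg M (know M x))"

primrec minus_model :: "el_base \<Rightarrow> 'a el_algebra \<Rightarrow> bool" where
  "minus_model EL5 M = EL5_minus_model M"
| "minus_model E4L5 M = E4L5_minus_model M"
| "minus_model E5L5 M = E5L5_minus_model M"
| "minus_model E6L5 M = E6L5_minus_model M"

primrec algebraic_model :: "el_logic \<Rightarrow> 'a el_algebra \<Rightarrow> bool" where
  "algebraic_model (Minus b) M \<longleftrightarrow> minus_model b M"
| "algebraic_model (Full b) M \<longleftrightarrow> minus_model b M \<and>
     (\<forall>x\<in>carrier M. know M x \<sqsubseteq>\<^bsub>M\<^esub> neg M (neg M x))"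

primrec value_of :: "'a el_algebra \<Rightarrow> ('v \<Rightarrow> 'a) \<Rightarrow> 'v fm \<Rightarrow> 'a" where
  "value_of M \<gamma> (Var x) = \<gamma> x"
| "value_of M \<gamma> Bot = \<bottom>\<^bsub>M\<^esub>"
| "value_of M \<gamma> (And \<phi> \<psi>) = value_of M \<gamma> \<phi> \<sqinter>\<^bsub>M\<^esub> value_of M \<gamma> \<psi>"
| "value_of M \<gamma> (Or \<phi> \<psi>) = value_of M \<gamma> \<phi> \<squnion>\<^bsub>M\<^esub> value_of M \<gamma> \<psi>"
| "value_of M \<gamma> (Imp \<phi> \<psi>) = value_of M \<gamma> \<phi> \<leadsto>\<^bsub>M\<^esub> value_of M \<gamma> \<psi>"
| "value_of M \<gamma> (Box \<phi>) = box M (value_of M \<gamma> \<phi>)"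
| "value_of M \<gamma> (Know \<phi>) = know M (value_of M \<gamma> \<phi>)"

definition algebraic_sat :: "'a el_algebra \<Rightarrow> ('v \<Rightarrow> 'a) \<Rightarrow> 'v fm \<Rightarrow> bool" where
  "algebraic_sat M \<gamma> \<phi> \<longleftrightarrow> value_of M \<gamma> \<phi> \<in> TRUE M"


section \<open>Frames and relational models\<close>

text \<open>
  The fields are the components $W$, $R$, $P$, $E$, $w_T$. The values of \<open>evid\<close>
  outside \<open>worlds\<close> are irrelevant.
\<close>

record 'w frame =
  worlds :: "'w set"
  acc :: "'w rel"
  props :: "'w set set"
  evid :: "'w \<Rightarrow> 'w set set"
  actual :: 'w

definition bot_world :: "'w frame \<Rightarrow> 'w" where
  "bot_world F = (THE b. b \<in> worlds F \<and> (\<forall>w\<in>worlds F. (b, w) \<in> acc F))"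

definition max_worlds :: "'w frame \<Rightarrow> 'w set" where
  "max_worlds F = {w \<in> worlds F. \<forall>w'\<in>worlds F. (w, w') \<in> acc F \<longrightarrow> w' = w}"

definition imp_prop :: "'w frame \<Rightarrow> 'w set \<Rightarrow> 'w set \<Rightarrow> 'w set" where
  "imp_prop F A B = {w \<in> worlds F. \<forall>w'\<in>acc F `` {w}. w' \<in> A \<longrightarrow> w' \<in> B}"

definition know_prop :: "'w frame \<Rightarrow> 'w set \<Rightarrow> 'w set" where
  "know_prop F A = {w \<in> worlds F. A \<in> evid F w}"

text \<open>Filters on \<open>P\<close> may contain \<open>{}\<close>, they need not be proper.\<close>

definition prop_filter :: "'w set set \<Rightarrow> 'w set set \<Rightarrow> bool" where
  "prop_filter P G \<longleftrightarrow> G \<subseteq> P \<and> G \<noteq> {} \<and> (\<forall>A\<in>G. \<forall>B\<in>G. A \<inter> B \<in> G) \<and>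
     (\<forall>A\<in>G. \<forall>B\<in>P. A \<subseteq> B \<longrightarrow> B \<in> G)"

locale EL5_minus_frame =
  fixes F :: "'w frame"
  assumes worlds_nonempty: "worlds F \<noteq> {}"
    and acc_order: "partial_order_on (worlds F) (acc F)"
    and least_world: "\<exists>b\<in>worlds F. \<forall>w\<in>worlds F. (b, w) \<in> acc F"
    and chain_bound: "C \<in> Chains (acc F) \<Longrightarrow> \<exists>u\<in>worlds F. \<forall>c\<in>C. (c, u) \<in> acc F"
    and props_upclosed: "A \<in> props F \<Longrightarrow> A \<subseteq> worlds F \<and> acc F `` A \<subseteq> A"
    and evid_filter: "w \<in> worlds F \<Longrightarrow> prop_filter (props F) (evid F w)"
    and evid_mono: "(w, w') \<in> acc F \<Longrightarrow> evid F w \<subseteq> evid F w'"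
    and actual_max: "actual F \<in> max_worlds F"
    and props_empty: "{} \<in> props F"
    and props_worlds: "worlds F \<in> props F"
    and props_Int: "\<lbrakk>A \<in> props F; B \<in> props F\<rbrakk> \<Longrightarrow> A \<inter> B \<in> props F"
    and props_Un: "\<lbrakk>A \<in> props F; B \<in> props F\<rbrakk> \<Longrightarrow> A \<union> B \<in> props F"
    and props_imp: "\<lbrakk>A \<in> props F; B \<in> props F\<rbrakk> \<Longrightarrow> imp_prop F A B \<in> props F"
    and props_know: "A \<in> props F \<Longrightarrow> know_prop F A \<in> props F"

locale E4L5_minus_frame = EL5_minus_frame +
  assumes evid_know: "\<lbrakk>w \<in> worlds F; A \<in> evid F w\<rbrakk> \<Longrightarrow> know_prop F A \<in> evid F w"

locale E5L5_minus_frame = E4L5_minus_frame +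
  assumes evid_neg_know:
    "\<lbrakk>w \<in> worlds F; A \<in> props F; \<And>w'. w' \<in> acc F `` {w} \<Longrightarrow> A \<notin> evid F w'\<rbrakk> \<Longrightarrow>
      imp_prop F (know_prop F A) {} \<in> evid F w"

locale E6L5_minus_frame = EL5_minus_frame +
  assumes evid_const: "w \<in> worlds F \<Longrightarrow> evid F w = evid F (bot_world F)"

primrec minus_frame :: "el_base \<Rightarrow> 'w frame \<Rightarrow> bool" where
  "minus_frame EL5 F = EL5_minus_frame F"
| "minus_frame E4L5 F = E4L5_minus_frame F"
| "minus_frame E5L5 F = E5L5_minus_frame F"
| "minus_frame E6L5 F = E6L5_minus_frame F"

primrec logic_frame :: "el_logic \<Rightarrow> 'w frame \<Rightarrow> bool" where
  "logic_frame (Minus b) F \<longleftrightarrow> minus_frame b F"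
| "logic_frame (Full b) F \<longleftrightarrow> minus_frame b F \<and>
     (\<forall>w\<in>worlds F. \<forall>A\<in>evid F w. max_worlds F \<inter> acc F `` {w} \<subseteq> A)"

primrec sat_at :: "'w frame \<Rightarrow> ('v \<Rightarrow> 'w set) \<Rightarrow> 'w \<Rightarrow> 'v fm \<Rightarrow> bool" where
  "sat_at F g w (Var x) \<longleftrightarrow> w \<in> g x"
| "sat_at F g w Bot \<longleftrightarrow> False"
| "sat_at F g w (And \<phi> \<psi>) \<longleftrightarrow> sat_at F g w \<phi> \<and> sat_at F g w \<psi>"
| "sat_at F g w (Or \<phi> \<psi>) \<longleftrightarrow> sat_at F g w \<phi> \<or> sat_at F g w \<psi>"
| "sat_at F g w (Imp \<phi> \<psi>) \<longleftrightarrow> (\<forall>w'\<in>acc F `` {w}. sat_at F g w' \<phi> \<longrightarrow> sat_at F g w' \<psi>)"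
| "sat_at F g w (Box \<phi>) \<longleftrightarrow> sat_at F g (bot_world F) \<phi>"
| "sat_at F g w (Know \<phi>) \<longleftrightarrow> {w' \<in> worlds F. sat_at F g w' \<phi>} \<in> evid F w"

definition relational_sat :: "'w frame \<Rightarrow> ('v \<Rightarrow> 'w set) \<Rightarrow> 'v fm \<Rightarrow> bool" where
  "relational_sat F g \<phi> \<longleftrightarrow> sat_at F g (actual F) \<phi>"

end

theory Submission
  imports Defs
begin

text \<open>
  The worlds are the prime filters of \<open>M\<close> ordered by inclusion, the propositions are the sets
  of prime filters containing a given element, and a proposition is known at a prime filter \<open>w\<close>
  if \<open>know M x \<in> w\<close> for the element \<open>x\<close> it represents. The disjunction property of \<open>box\<close>
  makes \<open>{\<top>}\<close> prime, so it is the least world, where exactly the formulas of value \<open>\<top>\<close>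
  hold. A truth lemma identifies satisfaction at \<open>w\<close> with membership in \<open>w\<close>, and \<open>TRUE M\<close>,
  being an ultrafilter, serves as the actual world.
\<close>

section \<open>Filters of Heyting algebras\<close>

text \<open>For a filter, omitting bottom amounts to being proper
  (\<open>filter_proper_iff\<close>); in this form properness passes to unions of chains at
  once.\<close>

definition prime_filter :: "('a, 'b) gorder_scheme \<Rightarrow> 'a set \<Rightarrow> bool" where
  "prime_filter L F \<longleftrightarrow> lattice_filter L F \<and> \<bottom>\<^bsub>L\<^esub> \<notin> F \<and>
     (\<forall>x\<in>carrier L. \<forall>y\<in>carrier L. x \<squnion>\<^bsub>L\<^esub> y \<in> F \<longrightarrow> x \<in> F \<or> y \<in> F)"

lemma prime_filterD:
  assumes "prime_filter L F"
  shows "lattice_filter L F" and "\<bottom>\<^bsub>L\<^esub> \<notin> F"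
    and "\<lbrakk>x \<squnion>\<^bsub>L\<^esub> y \<in> F; x \<in> carrier L; y \<in> carrier L\<rbrakk> \<Longrightarrow> x \<in> F \<or> y \<in> F"
  using assms by (auto simp: prime_filter_def)

lemma lattice_filterD:
  assumes "lattice_filter L F"
  shows "F \<subseteq> carrier L" and "F \<noteq> {}"
    and "\<lbrakk>x \<in> F; y \<in> F\<rbrakk> \<Longrightarrow> x \<sqinter>\<^bsub>L\<^esub> y \<in> F"
    and "\<lbrakk>x \<in> F; x \<sqsubseteq>\<^bsub>L\<^esub> y; y \<in> carrier L\<rbrakk> \<Longrightarrow> y \<in> F"
  using assms unfolding lattice_filter_def by blast+

lemma lattice_filter_Union_chain:
  assumes "C \<noteq> {}" and "\<And>F. F \<in> C \<Longrightarrow> lattice_filter L F"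
    and chain: "\<And>F G. \<lbrakk>F \<in> C; G \<in> C\<rbrakk> \<Longrightarrow> F \<subseteq> G \<or> G \<subseteq> F"
  shows "lattice_filter L (\<Union>C)"
  unfolding lattice_filter_def
proof (intro conjI ballI impI)
  show "\<Union>C \<subseteq> carrier L" using assms(2) lattice_filterD(1) by blast
  show "\<Union>C \<noteq> {}" using assms(1,2) lattice_filterD(2) by blast
  fix x assume x: "x \<in> \<Union>C"
  show "x \<sqinter>\<^bsub>L\<^esub> y \<in> \<Union>C" if "y \<in> \<Union>C" for y
  proof -
    from x that obtain F G where FG: "x \<in> F" "F \<in> C" "y \<in> G" "G \<in> C" by blast
    \<comment> \<open>\<open>D\<close> is the larger of \<open>F\<close> and
      \<open>G\<close>.\<close>
    then obtain D where "D \<in> C" "x \<in> D" "y \<in> D" using chain[of F G] by blast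
    then show ?thesis using lattice_filterD(3)[OF assms(2)] by blast
  qed
  show "y \<in> \<Union>C" if "y \<in> carrier L" "x \<sqsubseteq>\<^bsub>L\<^esub> y" for y
    using x that lattice_filterD(4)[OF assms(2)] by blast
qed

text \<open>A join in the union already lies in one member of the chain, and that member is prime.
  The union will bound a nonempty chain of worlds from above.\<close>

lemma prime_filter_Union_chain:
  assumes "C \<noteq> {}" and "\<And>F. F \<in> C \<Longrightarrow> prime_filter L F"
    and "\<And>F G. \<lbrakk>F \<in> C; G \<in> C\<rbrakk> \<Longrightarrow> F \<subseteq> G \<or> G \<subseteq> F"
  shows "prime_filter L (\<Union>C)"
  using lattice_filter_Union_chain[OF assms(1) _ assms(3), of L] assms(2)
  unfolding prime_filter_def by blast

section \<open>Residuation in filters and the prime filter theorem\<close>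

context heyting_algebra
begin

lemma imp_mp:
  assumes "x \<in> carrier H" "y \<in> carrier H"
  shows "(x \<leadsto> y) \<sqinter> x \<sqsubseteq> y"
  using residuation[OF assms imp_closed[OF assms]] imp_closed[OF assms] by simp

lemma imp_eq_top:
  assumes "x \<in> carrier H" "y \<in> carrier H" "x \<sqsubseteq> y"
  shows "x \<leadsto> y = \<top>"
proof -
  have "\<top> \<sqinter> x \<sqsubseteq> y"
    using le_trans[OF meet_right[of \<top> x] assms(3)] assms(1,2) by simp
  then have "\<top> \<sqsubseteq> x \<leadsto> y" using residuation[of x y \<top>] assms by simp
  then show ?thesis using assms imp_closed[of x y] by (intro le_antisym) auto
qed

lemma filter_top:
  assumes "lattice_filter H F"
  shows "\<top> \<in> F"
  using lattice_filterD[OF assms] top_higher top_closed by (metis ex_in_conv subsetD)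

lemma filter_meet_iff:
  assumes "lattice_filter H F" "x \<in> carrier H" "y \<in> carrier H"
  shows "x \<sqinter> y \<in> F \<longleftrightarrow> x \<in> F \<and> y \<in> F"
  using lattice_filterD[OF assms(1)] meet_left[OF assms(2,3)] meet_right[OF assms(2,3)] assms
  by blast

lemma filter_mp:
  assumes "lattice_filter H F" "x \<leadsto> y \<in> F" "x \<in> F" "y \<in> carrier H"
  shows "y \<in> F"
proof -
  have "x \<in> carrier H" using lattice_filterD(1)[OF assms(1)] assms(3) by blast
  then show ?thesis
    using lattice_filterD(3,4)[OF assms(1)] imp_mp[of x y] assms by blast
qed

lemma filter_proper_iff:
  assumes "lattice_filter H F"
  shows "F \<noteq> carrier H \<longleftrightarrow> \<bottom> \<notin> F"
  using lattice_filterD[OF assms] bottom_lower bottom_closed by blast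

lemma principal_filter:
  assumes "x \<in> carrier H"
  shows "lattice_filter H {z \<in> carrier H. x \<sqsubseteq> z}"
  unfolding lattice_filter_def
  using assms by (auto intro: meet_le le_trans)

text \<open>The filter generated by \<open>F\<close> and \<open>x\<close>.\<close>

lemma adjoin_filter:
  assumes F: "lattice_filter H F" and x: "x \<in> carrier H"
  shows "lattice_filter H {z \<in> carrier H. x \<leadsto> z \<in> F}"
    and "F \<subseteq> {z \<in> carrier H. x \<leadsto> z \<in> F}" and "x \<in> {z \<in> carrier H. x \<leadsto> z \<in> F}"
proof -
  note FD = lattice_filterD[OF F]
  \<comment> \<open>By residuation \<open>x \<leadsto> z\<close> lies above every \<open>f\<close>
    with \<open>f \<sqinter> x \<sqsubseteq> z\<close>. The inclusion of \<open>F\<close> and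
    closure under meets and upwards reduce to exhibiting such an \<open>f\<close>.\<close>
  have up: "x \<leadsto> z \<in> F" if "f \<in> F" "f \<sqinter> x \<sqsubseteq> z" "z \<in> carrier H" for f z
    using FD(4)[OF that(1)] residuation[of x z f] imp_closed[of x z] FD(1) x that by blast
  show sub: "F \<subseteq> {z \<in> carrier H. x \<leadsto> z \<in> F}"
    using FD(1) up meet_left x by blast
  show xin: "x \<in> {z \<in> carrier H. x \<leadsto> z \<in> F}"
    using imp_eq_top[OF x x] x filter_top[OF F] by simp
  show "lattice_filter H {z \<in> carrier H. x \<leadsto> z \<in> F}"
    unfolding lattice_filter_def
  proof (intro conjI ballI impI)
    show "{z \<in> carrier H. x \<leadsto> z \<in> F} \<noteq> {}" using xin by blast
    fix a assume a: "a \<in> {z \<in> carrier H. x \<leadsto> z \<in> F}"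
    let ?a = "x \<leadsto> a"
    have ac: "a \<in> carrier H" "?a \<in> carrier H" using a x imp_closed by auto
    show "a \<sqinter> b \<in> {z \<in> carrier H. x \<leadsto> z \<in> F}" if b: "b \<in> {z \<in> carrier H. x \<leadsto> z \<in> F}" for b
    proof -
      let ?b = "x \<leadsto> b"
      let ?f = "?a \<sqinter> ?b"
      have bc: "b \<in> carrier H" "?b \<in> carrier H" using b x imp_closed by auto
      have fc: "?f \<in> carrier H" using ac bc by simp
      have "?f \<sqsubseteq> ?a" "?f \<sqsubseteq> ?b" using meet_left meet_right ac bc by auto
      then have "?f \<sqinter> x \<sqsubseteq> a" "?f \<sqinter> x \<sqsubseteq> b"
        using residuation ac bc x fc by auto
      then have "?f \<sqinter> x \<sqsubseteq> a \<sqinter> b" using meet_le ac bc x fc by simp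
      then show ?thesis using up[of ?f "a \<sqinter> b"] a b FD(3) ac bc by simp
    qed
    show "b \<in> {z \<in> carrier H. x \<leadsto> z \<in> F}" if b: "b \<in> carrier H" "a \<sqsubseteq> b" for b
    proof -
      have "?a \<sqinter> x \<sqsubseteq> b" using le_trans[OF imp_mp[OF x ac(1)] b(2)] ac b x by simp
      then show ?thesis using up[of ?a b] a b by simp
    qed
  qed auto
qed

text \<open>Zorn's lemma gives \<open>G\<close> maximal among the filters that contain
  \<open>F\<close> and omit \<open>y\<close>. Adjoining an element outside \<open>G\<close> must
  produce \<open>y\<close>, so that element implies \<open>y\<close> modulo \<open>G\<close>; if two
  elements imply \<open>y\<close>, so does their join, which therefore cannot lie in
  \<open>G\<close>.\<close>

theorem prime_filter_extension:
  assumes F: "lattice_filter H F" and y: "y \<in> carrier H" "y \<notin> F"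
  obtains G where "prime_filter H G" "F \<subseteq> G" "y \<notin> G"
proof -
  let ?A = "{G. lattice_filter H G \<and> F \<subseteq> G \<and> y \<notin> G}"
  have "\<exists>G\<in>?A. \<forall>X\<in>?A. G \<subseteq> X \<longrightarrow> X = G"
  proof (rule subset_Zorn_nonempty)
    show "?A \<noteq> {}" using F y by blast
    fix C assume C: "C \<noteq> {}" "subset.chain ?A C"
    then have sub: "C \<subseteq> ?A" and ch: "\<And>X Y. \<lbrakk>X \<in> C; Y \<in> C\<rbrakk> \<Longrightarrow> X \<subseteq> Y \<or> Y \<subseteq> X"
      by (auto simp: subset_chain_def)
    have "lattice_filter H (\<Union>C)"
      by (rule lattice_filter_Union_chain[OF C(1)]) (use sub ch in auto)
    then show "\<Union>C \<in> ?A" using sub C(1) by blast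
  qed
  then obtain G where "G \<in> ?A" and max_A: "\<forall>X\<in>?A. G \<subseteq> X \<longrightarrow> X = G" ..
  then have G: "lattice_filter H G" "F \<subseteq> G" "y \<notin> G" by simp_all
  have max: "X = G" if "lattice_filter H X" "y \<notin> X" "G \<subseteq> X" for X
    using max_A that order_trans[OF G(2)] by simp
  have Gy: "a \<leadsto> y \<in> G" if "a \<in> carrier H" "a \<notin> G" for a
  proof (rule ccontr)
    assume "a \<leadsto> y \<notin> G"
    then have "{z \<in> carrier H. a \<leadsto> z \<in> G} = G"
      using max[OF adjoin_filter(1)[OF G(1) that(1)]] adjoin_filter(2)[OF G(1) that(1)] by simp
    then show False using adjoin_filter(3)[OF G(1) that(1)] that(2) by blast
  qed
  have "a \<in> G \<or> b \<in> G" if ab: "a \<in> carrier H" "b \<in> carrier H" "a \<squnion> b \<in> G" for a b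
  proof (rule ccontr)
    assume n: "\<not> (a \<in> G \<or> b \<in> G)"
    \<comment> \<open>Residuation does the work of distributivity: \<open>a\<close> and
      \<open>b\<close> both lie below \<open>?d \<leadsto> y\<close>, hence so does their join, and
      modus ponens with \<open>?d\<close> would put \<open>y\<close> into \<open>G\<close>.\<close>
    let ?d = "(a \<leadsto> y) \<sqinter> (b \<leadsto> y)"
    have cl: "a \<leadsto> y \<in> carrier H" "b \<leadsto> y \<in> carrier H" "?d \<in> carrier H" "?d \<leadsto> y \<in> carrier H"
      using ab y imp_closed by auto
    have "?d \<sqsubseteq> a \<leadsto> y" "?d \<sqsubseteq> b \<leadsto> y"
      using meet_left[OF cl(1,2)] meet_right[OF cl(1,2)] by simp_all
    then have "?d \<sqinter> a \<sqsubseteq> y" "?d \<sqinter> b \<sqsubseteq> y"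
      using residuation[OF ab(1) y(1) cl(3)] residuation[OF ab(2) y(1) cl(3)] by simp_all
    then have "a \<sqsubseteq> ?d \<leadsto> y" "b \<sqsubseteq> ?d \<leadsto> y"
      using residuation[OF cl(3) y(1)] ab meet_comm[of H ?d] by simp_all
    then have "a \<squnion> b \<sqsubseteq> ?d \<leadsto> y" using join_le ab cl by simp
    then have "?d \<leadsto> y \<in> G" using lattice_filterD(4)[OF G(1) ab(3) _ cl(4)] by simp
    moreover have "?d \<in> G" using lattice_filterD(3)[OF G(1) Gy[OF ab(1)] Gy[OF ab(2)]] n by simp
    ultimately show False using filter_mp[OF G(1) _ _ y(1)] G(3) by simp
  qed
  moreover have "\<bottom> \<notin> G" using lattice_filterD(4)[OF G(1) _ bottom_lower[OF y(1)] y(1)] G(3) by blast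
  ultimately have "prime_filter H G" using G(1) unfolding prime_filter_def by blast
  then show ?thesis using that G(2,3) by simp
qed

text \<open>This is the Kripke clause for implication over inclusion of filters. If
  \<open>x \<leadsto> y\<close> is not in \<open>F\<close>, the filter generated by \<open>F\<close>
  and \<open>x\<close> omits \<open>y\<close>, and a prime extension of it that still omits
  \<open>y\<close> is the refuting world.\<close>

lemma imp_mem_iff:
  assumes F: "lattice_filter H F" and x: "x \<in> carrier H" and y: "y \<in> carrier H"
  shows "x \<leadsto> y \<in> F \<longleftrightarrow> (\<forall>G. prime_filter H G \<and> F \<subseteq> G \<and> x \<in> G \<longrightarrow> y \<in> G)"
proof
  assume "x \<leadsto> y \<in> F"
  then show "\<forall>G. prime_filter H G \<and> F \<subseteq> G \<and> x \<in> G \<longrightarrow> y \<in> G"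
    using filter_mp y prime_filterD(1) by blast
next
  assume R: "\<forall>G. prime_filter H G \<and> F \<subseteq> G \<and> x \<in> G \<longrightarrow> y \<in> G"
  show "x \<leadsto> y \<in> F"
  proof (rule ccontr)
    assume "x \<leadsto> y \<notin> F"
    then have "y \<notin> {z \<in> carrier H. x \<leadsto> z \<in> F}" by simp
    then obtain G where "prime_filter H G" "{z \<in> carrier H. x \<leadsto> z \<in> F} \<subseteq> G" "y \<notin> G"
      using prime_filter_extension[OF adjoin_filter(1)[OF F x] y] by blast
    then show False using R adjoin_filter(2,3)[OF F x] by blast
  qed
qed

text \<open>A proper filter has a prime extension, and maximality forces that extension to be
  \<open>U\<close> itself.\<close>

lemma ultrafilter_prime:
  assumes "lattice_ultrafilter H U"
  shows "prime_filter H U"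
proof -
  have U: "lattice_filter H U" "U \<noteq> carrier H"
    and max: "\<And>F. \<lbrakk>lattice_filter H F; F \<noteq> carrier H; U \<subseteq> F\<rbrakk> \<Longrightarrow> F = U"
    using assms by (auto simp: lattice_ultrafilter_def)
  have "\<bottom> \<notin> U" using U filter_proper_iff by blast
  then obtain G where G: "prime_filter H G" "U \<subseteq> G"
    using prime_filter_extension[OF U(1) bottom_closed] by blast
  have "G \<noteq> carrier H" using prime_filterD[OF G(1)] filter_proper_iff by blast
  then have "G = U" using max prime_filterD(1)[OF G(1)] G(2) by blast
  then show ?thesis using G(1) by simp
qed

lemma neg_closed: "x \<in> carrier H \<Longrightarrow> neg H x \<in> carrier H"
  by (simp add: neg_def imp_closed)

lemma neg_mem_iff:
  assumes "lattice_filter H F" "x \<in> carrier H"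
  shows "neg H x \<in> F \<longleftrightarrow> (\<forall>G. prime_filter H G \<and> F \<subseteq> G \<longrightarrow> x \<notin> G)"
  unfolding neg_def imp_mem_iff[OF assms bottom_closed] using prime_filterD(2) by blast

end

section \<open>The canonical frame\<close>

text \<open>The Stone map into sets of prime filters.\<close>

definition prime_ext :: "('a, 'b) gorder_scheme \<Rightarrow> 'a \<Rightarrow> 'a set set" where
  "prime_ext L x = {F. prime_filter L F \<and> x \<in> F}"

text \<open>The evidence sets are given through representatives \<open>x\<close>; injectivity of the
  Stone map on the carrier makes the choice of representative immaterial
  (\<open>evid_iff\<close>).\<close>

definition canonical_frame :: "'a el_algebra \<Rightarrow> 'a set frame" where
  "canonical_frame M =
    \<lparr>worlds = {w. prime_filter M w},
     acc = {(v, w). prime_filter M v \<and> prime_filter M w \<and> v \<subseteq> w},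
     props = prime_ext M ` carrier M,
     evid = (\<lambda>w. prime_ext M ` {x \<in> carrier M. know M x \<in> w}),
     actual = TRUE M\<rparr>"

lemma canonical_frame_sel [simp]:
  "worlds (canonical_frame M) = {w. prime_filter M w}"
  "(v, w) \<in> acc (canonical_frame M) \<longleftrightarrow> prime_filter M v \<and> prime_filter M w \<and> v \<subseteq> w"
  "props (canonical_frame M) = prime_ext M ` carrier M"
  "evid (canonical_frame M) w = prime_ext M ` {x \<in> carrier M. know M x \<in> w}"
  "actual (canonical_frame M) = TRUE M"
  by (simp_all add: canonical_frame_def)

section \<open>The Stone map as an order and lattice embedding\<close>

context heyting_algebra
begin

text \<open>If \<open>x\<close> is not below \<open>y\<close>, the principal filter of
  \<open>x\<close> omits \<open>y\<close>, and a prime filter extending it separates the two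
  elements.\<close>

lemma prime_ext_mono_iff:
  assumes "x \<in> carrier H" "y \<in> carrier H"
  shows "prime_ext H x \<subseteq> prime_ext H y \<longleftrightarrow> x \<sqsubseteq> y"
proof
  assume sub: "prime_ext H x \<subseteq> prime_ext H y"
  show "x \<sqsubseteq> y"
  proof (rule ccontr)
    assume "\<not> x \<sqsubseteq> y"
    then have "y \<notin> {z \<in> carrier H. x \<sqsubseteq> z}" by simp
    then obtain G where "prime_filter H G" "{z \<in> carrier H. x \<sqsubseteq> z} \<subseteq> G" "y \<notin> G"
      using prime_filter_extension[OF principal_filter[OF assms(1)] assms(2)] by blast
    then show False using sub assms by (auto simp: prime_ext_def)
  qed
next
  assume "x \<sqsubseteq> y"
  then show "prime_ext H x \<subseteq> prime_ext H y"
    using lattice_filterD(4)[OF prime_filterD(1)] assms(2) by (auto simp: prime_ext_def)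
qed

lemma prime_ext_inj:
  assumes "x \<in> carrier H" "y \<in> carrier H"
  shows "prime_ext H x = prime_ext H y \<longleftrightarrow> x = y"
  using prime_ext_mono_iff assms le_antisym by (metis order_refl)

lemma prime_ext_bottom: "prime_ext H \<bottom> = {}"
  by (auto simp: prime_ext_def dest: prime_filterD(2))

lemma prime_ext_top: "prime_ext H \<top> = {w. prime_filter H w}"
  by (auto simp: prime_ext_def intro: filter_top dest: prime_filterD(1))

lemma prime_ext_meet:
  assumes "x \<in> carrier H" "y \<in> carrier H"
  shows "prime_ext H (x \<sqinter> y) = prime_ext H x \<inter> prime_ext H y"
  using filter_meet_iff[OF prime_filterD(1) assms] by (auto simp: prime_ext_def)

lemma prime_join_iff:
  assumes "prime_filter H w" "x \<in> carrier H" "y \<in> carrier H"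
  shows "x \<squnion> y \<in> w \<longleftrightarrow> x \<in> w \<or> y \<in> w"
  using prime_filterD(3)[OF assms(1)] lattice_filterD(4)[OF prime_filterD(1)[OF assms(1)]]
    join_left join_right join_closed assms(2,3) by metis

lemma prime_ext_join:
  assumes "x \<in> carrier H" "y \<in> carrier H"
  shows "prime_ext H (x \<squnion> y) = prime_ext H x \<union> prime_ext H y"
  using prime_join_iff[OF _ assms] by (auto simp: prime_ext_def)

end

section \<open>Knowledge, the least world and the truth lemma\<close>

context EL5_minus_model
begin

lemma imp_prop_prime_ext:
  assumes "x \<in> carrier M" "y \<in> carrier M"
  shows "imp_prop (canonical_frame M) (prime_ext M x) (prime_ext M y) = prime_ext M (x \<leadsto> y)"
  using imp_mem_iff[OF prime_filterD(1) assms] by (auto simp: imp_prop_def prime_ext_def)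

lemma imp_prop_empty_prime_ext:
  assumes "x \<in> carrier M"
  shows "imp_prop (canonical_frame M) (prime_ext M x) {} = prime_ext M (neg M x)"
  using imp_prop_prime_ext[OF assms bottom_closed] by (simp add: prime_ext_bottom neg_def)

lemma evid_iff:
  assumes "x \<in> carrier M"
  shows "prime_ext M x \<in> evid (canonical_frame M) w \<longleftrightarrow> know M x \<in> w"
  using prime_ext_inj assms by (auto simp: image_iff)

lemma know_prop_prime_ext:
  assumes "x \<in> carrier M"
  shows "know_prop (canonical_frame M) (prime_ext M x) = prime_ext M (know M x)"
  unfolding know_prop_def evid_iff[OF assms] by (simp add: prime_ext_def)

lemma top_neq_bottom: "\<top> \<noteq> \<bottom>"
  using filter_top prime_filterD[OF ultrafilter_prime[OF TRUE_ultrafilter]] by metis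

text \<open>Necessitation for knowledge comes from \<open>box_know\<close> at \<open>\<top>\<close>:
  there \<open>box M \<top>\<close> equals \<open>\<top>\<close>, and \<open>box\<close> is
  deflationary.\<close>

lemma know_top: "know M \<top> = \<top>"
proof -
  have kc: "know M \<top> \<in> carrier M" using know_closed by simp
  have "\<top> \<sqsubseteq> box M (know M \<top>)" using box_know[of \<top>] box_eq[of \<top>] by simp
  then have "\<top> \<sqsubseteq> know M \<top>" using le_trans[OF _ box_le[OF kc]] box_closed kc by simp
  then show ?thesis using kc by (intro le_antisym) auto
qed

text \<open>Together with \<open>know_top\<close> this makes \<open>know M\<close> act as a normal
  modality inside every filter; monotonicity and closure under meets follow.\<close>

lemma know_mp:
  assumes w: "lattice_filter M w" and "x \<in> carrier M" "y \<in> carrier M"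
    and "know M (x \<leadsto> y) \<in> w" "know M x \<in> w"
  shows "know M y \<in> w"
proof -
  have "know M x \<leadsto> know M y \<in> w"
    using lattice_filterD(4)[OF w assms(4) know_imp[OF assms(2,3)]] know_closed imp_closed assms
    by blast
  then show ?thesis using filter_mp[OF w] know_closed assms by blast
qed

lemma know_mono:
  assumes "lattice_filter M w" "x \<in> carrier M" "y \<in> carrier M" "x \<sqsubseteq> y" "know M x \<in> w"
  shows "know M y \<in> w"
  using know_mp[OF assms(1-3) _ assms(5)] imp_eq_top[OF assms(2-4)] know_top filter_top[OF assms(1)]
  by simp

lemma know_meet:
  assumes w: "lattice_filter M w" and c: "x \<in> carrier M" "y \<in> carrier M"
    and "know M x \<in> w" "know M y \<in> w"
  shows "know M (x \<sqinter> y) \<in> w"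
proof -
  \<comment> \<open>The curried form of the meet lets \<open>know_mp\<close> combine the two known
    elements one at a time.\<close>
  have "x \<sqsubseteq> y \<leadsto> x \<sqinter> y" using residuation[of y "x \<sqinter> y" x] c by simp
  then have "know M (y \<leadsto> x \<sqinter> y) \<in> w"
    using know_mono[OF w c(1) _ _ assms(4)] c imp_closed by simp
  then show ?thesis using know_mp[OF w c(2) _ _ assms(5)] c by simp
qed

text \<open>If neither \<open>x\<close> nor \<open>y\<close> were \<open>\<top>\<close>, both their
  boxes would be \<open>\<bottom>\<close>, so a join equal to \<open>\<top>\<close> would give
  \<open>\<top> \<sqsubseteq> \<bottom>\<close> by \<open>box_join\<close>.\<close>

lemma prime_top: "prime_filter M {\<top>}"
proof -
  have "x = \<top> \<or> y = \<top>" if c: "x \<in> carrier M" "y \<in> carrier M" and j: "x \<squnion> y = \<top>" for x y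
  proof (rule ccontr)
    assume "\<not> (x = \<top> \<or> y = \<top>)"
    then have "\<top> \<sqsubseteq> \<bottom> \<squnion> \<bottom>" using box_join[OF c] box_eq c j by simp
    moreover have "\<bottom> \<squnion> \<bottom> \<sqsubseteq> \<bottom>" by (simp add: join_le)
    ultimately have "\<top> \<sqsubseteq> \<bottom>" using le_trans by (meson bottom_closed join_closed top_closed)
    then show False using top_neq_bottom by (auto intro: le_antisym)
  qed
  moreover have "{\<top>} = {z \<in> carrier M. \<top> \<sqsubseteq> z}" by (auto intro: le_antisym)
  then have "lattice_filter M {\<top>}" using principal_filter[of \<top>] by simp
  ultimately show ?thesis using top_neq_bottom by (simp add: prime_filter_def)
qed

lemma bot_world_canonical: "bot_world (canonical_frame M) = {\<top>}"
  unfolding bot_world_def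
  using prime_top filter_top[OF prime_filterD(1)] by (intro the_equality) auto

lemma actual_max_canonical: "TRUE M \<in> max_worlds (canonical_frame M)"
proof -
  have "G = TRUE M" if G: "prime_filter M G" "TRUE M \<subseteq> G" for G
    using TRUE_ultrafilter prime_filterD(1,2)[OF G(1)] filter_proper_iff G(2)
    unfolding lattice_ultrafilter_def by blast
  then show ?thesis
    using ultrafilter_prime[OF TRUE_ultrafilter] by (auto simp: max_worlds_def)
qed

text \<open>The Stone map translates the three filter conditions: nonemptiness is
  \<open>know_top\<close>, intersection is \<open>know_meet\<close>, and upward closure is
  \<open>know_mono\<close> after inclusion has been reflected to the order of
  \<open>M\<close>.\<close>

lemma prop_filter_canonical:
  assumes w: "lattice_filter M w"
  shows "prop_filter (prime_ext M ` carrier M) (evid (canonical_frame M) w)"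
  unfolding prop_filter_def
proof (intro conjI ballI impI)
  show "evid (canonical_frame M) w \<noteq> {}"
    using evid_iff[OF top_closed] know_top filter_top[OF w] by (metis empty_iff)
  fix A assume "A \<in> evid (canonical_frame M) w"
  then obtain x where x: "A = prime_ext M x" "x \<in> carrier M" "know M x \<in> w" by auto
  show "A \<inter> B \<in> evid (canonical_frame M) w" if "B \<in> evid (canonical_frame M) w" for B
  proof -
    from that obtain y where y: "B = prime_ext M y" "y \<in> carrier M" "know M y \<in> w" by auto
    then show ?thesis
      using x know_meet[OF w] evid_iff[of "x \<sqinter> y" w] prime_ext_meet[of x y] by simp
  qed
  show "B \<in> evid (canonical_frame M) w" if "B \<in> prime_ext M ` carrier M" "A \<subseteq> B" for B
  proof -
    from that(1) obtain y where y: "B = prime_ext M y" "y \<in> carrier M" by auto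
    then have "x \<sqsubseteq> y" using that(2) x prime_ext_mono_iff by simp
    then show ?thesis using know_mono[OF w x(2) y(2)] evid_iff[OF y(2)] x y by simp
  qed
qed auto

lemma EL5_minus_frame_canonical: "EL5_minus_frame (canonical_frame M)"
proof
  let ?F = "canonical_frame M"
  show "worlds ?F \<noteq> {}" using prime_top by auto
  show "partial_order_on (worlds ?F) (acc ?F)"
    by (auto simp: partial_order_on_def preorder_on_def refl_on_def trans_def antisym_def)
  show "\<exists>b\<in>worlds ?F. \<forall>w\<in>worlds ?F. (b, w) \<in> acc ?F"
    using prime_top filter_top[OF prime_filterD(1)] by (intro bexI[of _ "{\<top>}"]) auto
  show "\<exists>u\<in>worlds ?F. \<forall>c\<in>C. (c, u) \<in> acc ?F" if C: "C \<in> Chains (acc ?F)" for C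
  proof (cases "C = {}")
    \<comment> \<open>The union of the empty chain is empty and so not a filter; the least world
      bounds it instead.\<close>
    case True
    then show ?thesis using prime_top by auto
  next
    case False
    \<comment> \<open>Comparability of a member of the chain with itself already makes it a
      world.\<close>
    have "prime_filter M w" if "w \<in> C" for w using C that by (auto simp: Chains_def)
    moreover have "v \<subseteq> w \<or> w \<subseteq> v" if "v \<in> C" "w \<in> C" for v w
      using C that by (auto simp: Chains_def)
    ultimately have "prime_filter M (\<Union>C)" "\<forall>w\<in>C. prime_filter M w"
      using prime_filter_Union_chain[OF False, of M] by simp_all
    then show ?thesis by (intro bexI[of _ "\<Union>C"]) auto
  qed
  show "A \<subseteq> worlds ?F \<and> acc ?F `` A \<subseteq> A" if "A \<in> props ?F" for A
    using that by (auto simp: prime_ext_def)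
  show "prop_filter (props ?F) (evid ?F w)" if "w \<in> worlds ?F" for w
    using prop_filter_canonical[OF prime_filterD(1)] that by simp
  show "evid ?F w \<subseteq> evid ?F w'" if "(w, w') \<in> acc ?F" for w w'
    using that by auto
  show "actual ?F \<in> max_worlds ?F" using actual_max_canonical by simp
  show "{} \<in> props ?F" using prime_ext_bottom bottom_closed by (metis canonical_frame_sel(3) imageI)
  show "worlds ?F \<in> props ?F" using prime_ext_top top_closed by (metis canonical_frame_sel(1,3) imageI)
  show "A \<inter> B \<in> props ?F" if "A \<in> props ?F" "B \<in> props ?F" for A B
    using that by (auto simp: prime_ext_meet[symmetric])
  show "A \<union> B \<in> props ?F" if "A \<in> props ?F" "B \<in> props ?F" for A B
    using that by (auto simp: prime_ext_join[symmetric])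
  show "imp_prop ?F A B \<in> props ?F" if "A \<in> props ?F" "B \<in> props ?F" for A B
    using that imp_prop_prime_ext imp_closed by auto
  show "know_prop ?F A \<in> props ?F" if "A \<in> props ?F" for A
    using that know_prop_prime_ext know_closed by auto
qed

text \<open>Both claims go through one induction, since the clauses for connectives need values in
  the carrier. The world stays arbitrary because \<open>Imp\<close>, \<open>Box\<close> and
  \<open>Know\<close> evaluate subformulas at other worlds.\<close>

lemma truth_lemma:
  assumes \<gamma>: "\<gamma> \<in> UNIV \<rightarrow> carrier M"
  shows "value_of M \<gamma> \<phi> \<in> carrier M"
    and "prime_filter M w \<Longrightarrow>
      sat_at (canonical_frame M) (\<lambda>p. prime_ext M (\<gamma> p)) w \<phi> \<longleftrightarrow> value_of M \<gamma> \<phi> \<in> w"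
proof (induction \<phi> arbitrary: w)
  case (Var p)
  { case 1 then show ?case using \<gamma> by auto }
  { case 2 then show ?case by (simp add: prime_ext_def) }
next
  case Bot
  { case 1 then show ?case by simp }
  { case 2 then show ?case using prime_filterD(2) by simp }
next
  case (And \<phi> \<psi>)
  { case 1 then show ?case using And by simp }
  { case 2 then show ?case using And filter_meet_iff[OF prime_filterD(1)[OF 2]] by simp }
next
  case (Or \<phi> \<psi>)
  { case 1 then show ?case using Or by simp }
  { case 2 then show ?case using Or prime_join_iff by simp }
next
  case (Imp \<phi> \<psi>)
  { case 1 then show ?case using Imp imp_closed by simp }
  { case 2 then show ?case
      using Imp imp_mem_iff[OF prime_filterD(1)[OF 2] Imp(1) Imp(3)] by auto }
next
  case (Box \<phi>)
  { case 1 then show ?case using Box box_closed by simp }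
  { case 2
    \<comment> \<open>A boxed value is \<open>\<top>\<close> or \<open>\<bottom>\<close>, so it lies
      in \<open>w\<close> exactly when the value inside is \<open>\<top>\<close>, that is, belongs
      to the least world \<open>{\<top>}\<close>.\<close>
    have "\<top> \<in> w" "\<bottom> \<notin> w" using prime_filterD[OF 2] filter_top by auto
    then show ?case using Box(2)[OF prime_top] box_eq[OF Box(1)] by (simp add: bot_world_canonical) }
next
  case (Know \<phi>)
  { case 1 then show ?case using Know know_closed by simp }
  { case 2
    \<comment> \<open>The induction hypothesis at all worlds identifies the truth set with the
      proposition represented by the value.\<close>
    have "{w' \<in> worlds (canonical_frame M). sat_at (canonical_frame M) (\<lambda>p. prime_ext M (\<gamma> p)) w' \<phi>}
        = prime_ext M (value_of M \<gamma> \<phi>)"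
      using Know(2) by (auto simp: prime_ext_def)
    then show ?case using evid_iff[OF Know(1)] by simp }
qed

text \<open>Negation is classical at a maximal world \<open>v\<close>: its only prime extension is
  \<open>v\<close>, so \<open>v\<close> contains \<open>x\<close> whenever it omits
  \<open>neg M x\<close>. Hence the double negation obtained from \<open>know M x\<close> yields
  \<open>x\<close> itself.\<close>

lemma max_worlds_canonical_know:
  assumes nn: "\<And>x. x \<in> carrier M \<Longrightarrow> know M x \<sqsubseteq> neg M (neg M x)"
    and w: "prime_filter M w" and A: "A \<in> evid (canonical_frame M) w"
  shows "max_worlds (canonical_frame M) \<inter> acc (canonical_frame M) `` {w} \<subseteq> A"
proof
  fix v assume v: "v \<in> max_worlds (canonical_frame M) \<inter> acc (canonical_frame M) `` {w}"
  then have vp: "prime_filter M v" "w \<subseteq> v"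
    and vmax: "\<And>u. \<lbrakk>prime_filter M u; v \<subseteq> u\<rbrakk> \<Longrightarrow> u = v"
    by (auto simp: max_worlds_def)
  obtain x where x: "A = prime_ext M x" "x \<in> carrier M" "know M x \<in> w" using A by auto
  have "neg M (neg M x) \<in> v"
    using lattice_filterD(4)[OF prime_filterD(1)[OF vp(1)] _ nn] x vp(2) neg_closed by blast
  then have "neg M x \<notin> v"
    using neg_mem_iff[OF prime_filterD(1) neg_closed] vp(1) x(2) by blast
  then have "x \<in> v"
    using neg_mem_iff[OF prime_filterD(1) x(2)] vp(1) vmax by blast
  then show "v \<in> A" using x vp by (simp add: prime_ext_def)
qed

end

section \<open>Frame conditions of the stronger logics\<close>

lemma (in E4L5_minus_model) E4L5_minus_frame_canonical: "E4L5_minus_frame (canonical_frame M)"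
proof -
  let ?F = "canonical_frame M"
  interpret F: EL5_minus_frame ?F by (rule EL5_minus_frame_canonical)
  show ?thesis
  proof
    fix w A assume w: "w \<in> worlds ?F" and A: "A \<in> evid ?F w"
    then obtain x where x: "A = prime_ext M x" "x \<in> carrier M" "know M x \<in> w" by auto
    have "lattice_filter M w" using w prime_filterD(1) by auto
    then have "know M (know M x) \<in> w"
      using lattice_filterD(4)[OF _ x(3) know_know[OF x(2)]] know_closed x(2) by simp
    then show "know_prop ?F A \<in> evid ?F w"
      using evid_iff[OF know_closed] know_prop_prime_ext x by simp
  qed
qed

lemma (in E5L5_minus_model) E5L5_minus_frame_canonical: "E5L5_minus_frame (canonical_frame M)"
proof -
  let ?F = "canonical_frame M"
  interpret F: E4L5_minus_frame ?F by (rule E4L5_minus_frame_canonical)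
  show ?thesis
  proof
    fix w A assume w: "w \<in> worlds ?F" and A: "A \<in> props ?F"
      and none: "\<And>w'. w' \<in> acc ?F `` {w} \<Longrightarrow> A \<notin> evid ?F w'"
    obtain x where x: "A = prime_ext M x" "x \<in> carrier M" using A by auto
    have lf: "lattice_filter M w" using w prime_filterD(1) by auto
    have kc: "know M x \<in> carrier M" using know_closed x by simp
    have "know M x \<notin> G" if "prime_filter M G" "w \<subseteq> G" for G
      using none[of G] that w evid_iff[OF x(2)] x(1) by simp
    \<comment> \<open>Absence of evidence at all successors says that no prime extension of
      \<open>w\<close> contains \<open>know M x\<close>, which is membership of its negation in
      \<open>w\<close>.\<close>
    then have "neg M (know M x) \<in> w" using neg_mem_iff[OF lf kc] by blast
    then have "know M (neg M (know M x)) \<in> w"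
      using lattice_filterD(4)[OF lf _ neg_know[OF x(2)]] know_closed neg_closed kc by simp
    then show "imp_prop ?F (know_prop ?F A) {} \<in> evid ?F w"
      using evid_iff[OF neg_closed[OF kc]] know_prop_prime_ext imp_prop_empty_prime_ext[OF kc] x
      by simp
  qed
qed

text \<open>Since \<open>know M x\<close> lies below its own box and \<open>box\<close> takes only
  the values \<open>\<top>\<close> and \<open>\<bottom>\<close>, so does \<open>know M\<close>. All
  prime filters agree on these two values, so evidence is constant.\<close>

lemma (in E6L5_minus_model) E6L5_minus_frame_canonical: "E6L5_minus_frame (canonical_frame M)"
proof -
  let ?F = "canonical_frame M"
  interpret F: EL5_minus_frame ?F by (rule EL5_minus_frame_canonical)
  show ?thesis
  proof
    fix w assume "w \<in> worlds ?F"
    then have "prime_filter M w" by simp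
    then have w: "\<top> \<in> w" "\<bottom> \<notin> w"
      using filter_top[OF prime_filterD(1)] prime_filterD(2) by simp_all
    have "know M x = \<top> \<or> know M x = \<bottom>" if "x \<in> carrier M" for x
      using know_box[OF that] box_eq[OF know_closed[OF that]] bottom_lower[OF know_closed[OF that]]
        le_antisym[OF _ _ know_closed[OF that] bottom_closed] by auto
    then have "{x \<in> carrier M. know M x \<in> w} = {x \<in> carrier M. know M x \<in> {\<top>}}"
      using w by (metis singleton_iff)
    then show "evid ?F w = evid ?F (bot_world ?F)"
      by (simp add: bot_world_canonical)
  qed
qed

section \<open>Assembly over all logics\<close>

lemma minus_model_EL5_minus_model:
  assumes "minus_model b M"
  shows "EL5_minus_model M"
  using assms
  by (cases b) (auto simp: E4L5_minus_model_def E5L5_minus_model_def E6L5_minus_model_def)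

lemma minus_frame_canonical:
  assumes "minus_model b M"
  shows "minus_frame b (canonical_frame M)"
  using assms EL5_minus_model.EL5_minus_frame_canonical E4L5_minus_model.E4L5_minus_frame_canonical
    E5L5_minus_model.E5L5_minus_frame_canonical E6L5_minus_model.E6L5_minus_frame_canonical
  by (cases b) auto

lemma logic_frame_canonical:
  assumes "algebraic_model L M"
  shows "logic_frame L (canonical_frame M)"
proof (cases L)
  case (Minus b)
  then show ?thesis using assms minus_frame_canonical by auto
next
  case (Full b)
  then have m: "minus_model b M"
    and nn: "\<And>x. x \<in> carrier M \<Longrightarrow> know M x \<sqsubseteq>\<^bsub>M\<^esub> neg M (neg M x)"
    using assms by auto
  interpret EL5_minus_model M by (rule minus_model_EL5_minus_model[OF m])
  show ?thesis
    using Full minus_frame_canonical[OF m] max_worlds_canonical_know[OF nn]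
    \<comment> \<open>Only worlds are unfolded to prime filters; accessibility and evidence keep the
      form in which \<open>max_worlds_canonical_know\<close> speaks of them.\<close>
    by (simp del: canonical_frame_sel(2-))
qed

theorem theorem4p7:
  fixes L :: el_logic and M :: "'m el_algebra" and \<gamma> :: "'v \<Rightarrow> 'm"
  assumes "algebraic_model L M"
    and "\<gamma> \<in> UNIV \<rightarrow> carrier M"
  shows "\<exists>(F :: 'm set frame) (g :: 'v \<Rightarrow> 'm set set).
    logic_frame L F \<and> g \<in> UNIV \<rightarrow> props F \<and>
    (\<forall>\<phi> :: 'v fm. algebraic_sat M \<gamma> \<phi> \<longleftrightarrow> relational_sat F g \<phi>)"
proof -
  have "EL5_minus_model M"
    using assms(1) minus_model_EL5_minus_model by (cases L) auto
  then interpret EL5_minus_model M .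
  let ?g = "\<lambda>p. prime_ext M (\<gamma> p)"
  have "?g \<in> UNIV \<rightarrow> props (canonical_frame M)" using assms(2) by auto
  moreover have "\<forall>\<phi>. algebraic_sat M \<gamma> \<phi> \<longleftrightarrow> relational_sat (canonical_frame M) ?g \<phi>"
    using truth_lemma(2)[OF assms(2) ultrafilter_prime[OF TRUE_ultrafilter]]
    by (simp add: algebraic_sat_def relational_sat_def)
  ultimately show ?thesis using logic_frame_canonical[OF assms(1)] by blast
qed

end
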